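(* Let $k$ be a field of characteristic different from $2$ containing a square root of $-1$, let $n\geq 2$ be an integer, let $x_1,\ldots,x_n$ be independent indeterminates over $k$, put $x_0=x_1\cdots x_n$ and $K=k(x_1,\ldots,x_n)$, and consider the quadratic forms over $K$ \[ q=\langle x_1,\ldots,x_n\rangle,\quad q_0=\langle x_0,x_1,\ldots,x_n\rangle,\quad q'=\langle 1,x_1,\ldots,x_n\rangle,\quad q'_0=\langle 1,x_0,x_1,\ldots,x_n\rangle. \] If $n$ is even, then $q\in I(K)$, $q'_0\in I^2(K)$, and \[ \mathrm{Pf}_1(q)=n\qquad\text{and}\qquad \mathrm{Pf}_2(q'_0)=n-1. \] If $n$ is odd, then $q'\in I(K)$, $q_0\in I^2(K)$, and \[ \mathrm{Pf}_1(q')=n\qquad\text{and}\qquad \mathrm{Pf}_2(q_0)=n-1. \]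
   Context: For a field $F$ of characteristic $\neq 2$, $W(F)$ denotes the Witt ring, $I(F)$ its fundamental ideal (classes of even-dimensional forms) and $I^m(F)$ its $m$-th power; a form is "in $I^m(F)$" if its Witt class is. $\langle a_1,\ldots,a_n\rangle$ denotes the diagonal form $\sum a_iX_i^2$. An $m$-fold Pfister form is $\langle\langle a_1,\ldots,a_m\rangle\rangle=\langle 1,a_1\rangle\otimes\cdots\otimes\langle 1,a_m\rangle$ with $a_i\in F^\times$. For $q\in I^m(F)$, the $m$-Pfister number $\mathrm{Pf}_m(q)$ is the least number of terms in an expression of the Witt class of $q$ as a sum of $m$-fold Pfister forms in $W(F)$. *)

theory Defs
  imports Main
begin

definition is_subfield :: "'a::field set \<Rightarrow> bool" where
  "is_subfield S \<longleftrightarrow> 0 \<in> S \<and> 1 \<in> S \<and>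
     (\<forall>a\<in>S. \<forall>b\<in>S. a + b \<in> S \<and> a - b \<in> S \<and> a * b \<in> S) \<and>
     (\<forall>a\<in>S. inverse a \<in> S)"

definition generates_field :: "'a::field set \<Rightarrow> (nat \<Rightarrow> 'a) \<Rightarrow> nat \<Rightarrow> bool" where
  "generates_field k x n \<longleftrightarrow>
     (\<forall>S. is_subfield S \<and> k \<subseteq> S \<and> x ` {1..n} \<subseteq> S \<longrightarrow> S = UNIV)"

definition alg_indep :: "'a::field set \<Rightarrow> (nat \<Rightarrow> 'a) \<Rightarrow> nat \<Rightarrow> bool" where
  "alg_indep k x n \<longleftrightarrow>
     (\<forall>S c. finite S \<and> S \<subseteq> {\<alpha>::nat \<Rightarrow> nat. \<forall>i. i \<notin> {1..n} \<longrightarrow> \<alpha> i = 0}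
        \<and> (\<forall>\<alpha>\<in>S. c \<alpha> \<in> k)
        \<and> (\<Sum>\<alpha>\<in>S. c \<alpha> * (\<Prod>i=1..n. x i ^ \<alpha> i)) = 0
        \<longrightarrow> (\<forall>\<alpha>\<in>S. c \<alpha> = 0))"

definition qf_val :: "'a::field list \<Rightarrow> (nat \<Rightarrow> 'a) \<Rightarrow> 'a" where
  "qf_val a v = (\<Sum>i<length a. a ! i * (v i)^2)"

definition nondeg :: "'a::field list \<Rightarrow> bool" where
  "nondeg a \<longleftrightarrow> (\<forall>c\<in>set a. c \<noteq> 0)"

definition isometric :: "'a::field list \<Rightarrow> 'a list \<Rightarrow> bool" where
  "isometric a b \<longleftrightarrow> length a = length b \<and>
     (\<exists>P Q :: nat \<Rightarrow> nat \<Rightarrow> 'a.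
        (\<forall>i<length a. \<forall>j<length a.
            (\<Sum>l<length a. P i l * Q l j) = (if i = j then 1 else 0)) \<and>
        (\<forall>v. qf_val a (\<lambda>i. \<Sum>j<length a. P i j * v j) = qf_val b v))"

definition hyp :: "nat \<Rightarrow> 'a::field list" where
  "hyp m = concat (replicate m [1, -1])"

definition witt_eq :: "'a::field list \<Rightarrow> 'a list \<Rightarrow> bool" where
  "witt_eq a b \<longleftrightarrow> (\<exists>m m'. isometric (a @ hyp m) (b @ hyp m'))"

definition tensor :: "'a::field list \<Rightarrow> 'a list \<Rightarrow> 'a list" where
  "tensor a b = concat (map (\<lambda>s. map (\<lambda>t. s * t) b) a)"

fun pfister :: "'a::field list \<Rightarrow> 'a list" where
  "pfister [] = [1]"
| "pfister (c # cs) = tensor [1, c] (pfister cs)"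

definition pfister_args :: "nat \<Rightarrow> 'a::field list \<Rightarrow> bool" where
  "pfister_args m cs \<longleftrightarrow> length cs = m \<and> (\<forall>c\<in>set cs. c \<noteq> 0)"

text \<open>The Witt class of q lies in I^m(F): it is a finite signed sum of m-fold Pfister forms
  (I^m(F) is additively generated by the classes of m-fold Pfister forms).\<close>
definition in_Im :: "nat \<Rightarrow> 'a::field list \<Rightarrow> bool" where
  "in_Im m q \<longleftrightarrow> nondeg q \<and>
     (\<exists>L :: (bool \<times> 'a list) list. (\<forall>(e, cs)\<in>set L. pfister_args m cs) \<and>
        witt_eq q (concat (map (\<lambda>(e, cs). if e then pfister cs else map uminus (pfister cs)) L)))"

definition sum_of_pfisters :: "nat \<Rightarrow> nat \<Rightarrow> 'a::field list \<Rightarrow> bool" where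
  "sum_of_pfisters m N q \<longleftrightarrow>
     (\<exists>L :: 'a list list. length L = N \<and> (\<forall>cs\<in>set L. pfister_args m cs) \<and>
        witt_eq q (concat (map pfister L)))"

definition Pf :: "nat \<Rightarrow> 'a::field list \<Rightarrow> nat" where
  "Pf m q = (LEAST N. sum_of_pfisters m N q)"

end

(* Sending a nonzero element of K to the parity vector in V = F_2^n of its leading exponent, for a
   monomial order on K = k(x_1,...,x_n), induces a ring homomorphism from W(K) to the group ring
   F_2[V]; this uses that -1 is a square. The images of the x_i form the standard basis of V, and
   a 2-fold Pfister form becomes the sum of the elements of a subspace of dimension at most 2 (a
   line), or zero. So Pf_2 is at least the number of lines needed to add up, modulo 2, to the
   circuit formed by the basis vectors and their sum. The lines connected to e_1 add up to a part
   of the circuit; since the points of a line have sum zero in V, so have the points of that part,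
   which is therefore the whole circuit. Hence these lines span V, while m connected lines span at
   most m + 1 dimensions. The upper bounds are the telescoping sums of the forms <<x_i>> and
   <<x_1...x_(i-1), x_i>>. *)

theory Submission
  imports Defs "HOL-Library.Poly_Mapping" "HOL-Library.Function_Algebras" "HOL-Library.Z2"
    "HOL-Combinatorics.Permutations"
begin

section \<open>Parity of the leading exponent\<close>

lemma poly_mapping_expansion:
  "p = (\<Sum>\<alpha>\<in>Poly_Mapping.keys p. Poly_Mapping.single \<alpha> (Poly_Mapping.lookup p \<alpha>))"
proof (rule poly_mapping_eqI)
  fix \<beta>
  show "Poly_Mapping.lookup p \<beta> =
    Poly_Mapping.lookup (\<Sum>\<alpha>\<in>Poly_Mapping.keys p. Poly_Mapping.single \<alpha> (Poly_Mapping.lookup p \<alpha>)) \<beta>"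
    by (cases "\<beta> \<in> Poly_Mapping.keys p")
       (auto simp: lookup_sum lookup_single when_def in_keys_iff)
qed

lemma times_expansion:
  fixes p q :: "'m::monoid_add \<Rightarrow>\<^sub>0 'c::semiring_0"
  shows "p * q = (\<Sum>\<alpha>\<in>Poly_Mapping.keys p. \<Sum>\<beta>\<in>Poly_Mapping.keys q.
    Poly_Mapping.single (\<alpha> + \<beta>) (Poly_Mapping.lookup p \<alpha> * Poly_Mapping.lookup q \<beta>))"
proof -
  have "p * q = (\<Sum>\<alpha>\<in>Poly_Mapping.keys p. Poly_Mapping.single \<alpha> (Poly_Mapping.lookup p \<alpha>)) *
      (\<Sum>\<beta>\<in>Poly_Mapping.keys q. Poly_Mapping.single \<beta> (Poly_Mapping.lookup q \<beta>))"
    by (simp flip: poly_mapping_expansion)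
  then show ?thesis by (simp add: sum_product mult_single)
qed

lemma lookup_times:
  fixes p q :: "'m::monoid_add \<Rightarrow>\<^sub>0 'c::semiring_0"
  shows "Poly_Mapping.lookup (p * q) \<gamma> =
    (\<Sum>\<alpha>\<in>Poly_Mapping.keys p. \<Sum>\<beta>\<in>Poly_Mapping.keys q. (Poly_Mapping.lookup p \<alpha> * Poly_Mapping.lookup q \<beta> when \<alpha> + \<beta> = \<gamma>))"
proof -
  show ?thesis by (subst times_expansion) (simp add: lookup_sum lookup_single)
qed

section \<open>Leading exponents under a monomial order\<close>

definition lead :: "('m::linorder \<Rightarrow>\<^sub>0 'c::zero) \<Rightarrow> 'm" where
  "lead p = Max (Poly_Mapping.keys p)"

lemma lead_in_keys: "p \<noteq> 0 \<Longrightarrow> lead p \<in> Poly_Mapping.keys p"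
  unfolding lead_def by (intro Max_in) (auto simp: poly_mapping_eq_iff fun_eq_iff in_keys_iff)

lemma lead_eqI:
  "\<alpha> \<in> Poly_Mapping.keys p \<Longrightarrow> (\<And>\<beta>. \<beta> \<in> Poly_Mapping.keys p \<Longrightarrow> \<beta> \<le> \<alpha>) \<Longrightarrow> lead p = \<alpha>"
  unfolding lead_def by (intro Max_eqI) auto

text \<open>By strict monotonicity of addition, only the two leading exponents add up to the top
  exponent. The coefficient there is a single product of nonzero elements of a domain, so nothing
  cancels.\<close>

lemma lead_mult:
  fixes p q :: "'m::{ordered_cancel_comm_monoid_add,linorder} \<Rightarrow>\<^sub>0 'c::idom"
  assumes "p \<noteq> 0" "q \<noteq> 0"
  shows "lead (p * q) = lead p + lead q"
proof (rule lead_eqI)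
  have le: "\<alpha> \<le> lead p" if "\<alpha> \<in> Poly_Mapping.keys p" for \<alpha>
    using that by (simp add: lead_def)
  have le': "\<beta> \<le> lead q" if "\<beta> \<in> Poly_Mapping.keys q" for \<beta>
    using that by (simp add: lead_def)
  have eq: "\<alpha> + \<beta> = lead p + lead q \<longleftrightarrow> \<alpha> = lead p \<and> \<beta> = lead q"
    if "\<alpha> \<in> Poly_Mapping.keys p" "\<beta> \<in> Poly_Mapping.keys q" for \<alpha> \<beta>
    using le[OF that(1)] le'[OF that(2)] add_le_less_mono add_less_le_mono
    by (metis order_le_less less_irrefl)
  have "Poly_Mapping.lookup (p * q) (lead p + lead q) =
    (\<Sum>\<alpha>\<in>Poly_Mapping.keys p. \<Sum>\<beta>\<in>Poly_Mapping.keys q.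
       if \<alpha> = lead p \<and> \<beta> = lead q then Poly_Mapping.lookup p \<alpha> * Poly_Mapping.lookup q \<beta> else 0)"
    unfolding lookup_times when_def by (intro sum.cong refl) (simp add: eq)
  also have "\<dots> = (\<Sum>\<alpha>\<in>Poly_Mapping.keys p. if \<alpha> = lead p then Poly_Mapping.lookup p \<alpha> * Poly_Mapping.lookup q (lead q) else 0)"
    using lead_in_keys[OF assms(2)] by (intro sum.cong refl) auto
  also have "\<dots> = Poly_Mapping.lookup p (lead p) * Poly_Mapping.lookup q (lead q)"
    using lead_in_keys[OF assms(1)] by simp
  finally show "lead p + lead q \<in> Poly_Mapping.keys (p * q)"
    using lead_in_keys[OF assms(1)] lead_in_keys[OF assms(2)] by (simp add: in_keys_iff)
  fix \<gamma> assume "\<gamma> \<in> Poly_Mapping.keys (p * q)"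
  then obtain \<alpha> \<beta> where "\<gamma> = \<alpha> + \<beta>" "\<alpha> \<in> Poly_Mapping.keys p" "\<beta> \<in> Poly_Mapping.keys q"
    using keys_mult[of p q] by auto
  then show "\<gamma> \<le> lead p + lead q" using le le' by (simp add: add_mono)
qed

text \<open>The larger of the two leading exponents is not an exponent of the other summand, so its
  coefficient survives.\<close>

lemma lead_add:
  fixes p q :: "'m::linorder \<Rightarrow>\<^sub>0 'c::cancel_comm_monoid_add"
  assumes "p \<noteq> 0" "q \<noteq> 0" "lead p \<noteq> lead q"
  shows "lead (p + q) \<in> {lead p, lead q}"
proof -
  have *: "lead (p + q) = lead q"
    if "p \<noteq> 0" "q \<noteq> 0" "lead p < lead q" for p q :: "'m \<Rightarrow>\<^sub>0 'c"
  proof (rule lead_eqI)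
    have "lead q \<notin> Poly_Mapping.keys p"
      using that(3) by (metis Max_ge finite_keys lead_def leD)
    then show "lead q \<in> Poly_Mapping.keys (p + q)"
      using lead_in_keys[OF that(2)] by (simp add: in_keys_iff lookup_add)
    fix \<gamma> assume "\<gamma> \<in> Poly_Mapping.keys (p + q)"
    then have "\<gamma> \<in> Poly_Mapping.keys p \<or> \<gamma> \<in> Poly_Mapping.keys q" using keys_add[of p q] by auto
    then have "\<gamma> \<le> lead p \<or> \<gamma> \<le> lead q" by (auto simp: lead_def)
    then show "\<gamma> \<le> lead q" using that(3) by auto
  qed
  show ?thesis
    using assms *[of p q] *[of q p] by (cases "lead p < lead q") (auto simp: add.commute)
qed

section \<open>Polynomials over \<open>k\<close> evaluated at the generators\<close>

definition peval :: "nat \<Rightarrow> (nat \<Rightarrow> 'a::field) \<Rightarrow> ((nat \<Rightarrow>\<^sub>0 nat) \<Rightarrow>\<^sub>0 'a) \<Rightarrow> 'a" where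
  "peval n x p = (\<Sum>\<alpha>\<in>Poly_Mapping.keys p. Poly_Mapping.lookup p \<alpha> * (\<Prod>i=1..n. x i ^ Poly_Mapping.lookup \<alpha> i))"

lemma peval_superset:
  assumes "finite S" "Poly_Mapping.keys p \<subseteq> S"
  shows "peval n x p = (\<Sum>\<alpha>\<in>S. Poly_Mapping.lookup p \<alpha> * (\<Prod>i=1..n. x i ^ Poly_Mapping.lookup \<alpha> i))"
  unfolding peval_def using assms by (intro sum.mono_neutral_left) (auto simp: in_keys_iff)

lemma peval_single: "peval n x (Poly_Mapping.single \<alpha> c) = c * (\<Prod>i=1..n. x i ^ Poly_Mapping.lookup \<alpha> i)"
  by (subst peval_superset[of "{\<alpha>}"]) auto

lemma peval_var:
  assumes "i \<in> {1..n}"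
  shows "peval n x (Poly_Mapping.single (Poly_Mapping.single i 1) 1) = x i"
proof -
  have "peval n x (Poly_Mapping.single (Poly_Mapping.single i 1) 1) = (\<Prod>j=1..n. if j = i then x j else 1)"
    unfolding peval_single mult_1 by (intro prod.cong) (auto simp: lookup_single when_def)
  also have "\<dots> = x i" using assms by simp
  finally show ?thesis .
qed

lemma peval_0: "peval n x 0 = 0"
  by (simp add: peval_def)

lemma peval_add: "peval n x (p + q) = peval n x p + peval n x q"
  using keys_add[of p q]
  by (subst (1 2 3) peval_superset[of "Poly_Mapping.keys p \<union> Poly_Mapping.keys q"])
     (auto simp: lookup_add algebra_simps sum.distrib)

lemma peval_uminus: "peval n x (- p) = - peval n x p"
  using peval_add[of n x p "- p"] by (simp add: peval_0 add_eq_0_iff)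

lemma peval_sum: "peval n x (\<Sum>i\<in>I. f i) = (\<Sum>i\<in>I. peval n x (f i))"
  by (induction I rule: infinite_finite_induct) (auto simp: peval_0 peval_add)

lemma peval_mult: "peval n x (p * q) = peval n x p * peval n x q"
proof -
  have "peval n x (p * q) = (\<Sum>\<alpha>\<in>Poly_Mapping.keys p. \<Sum>\<beta>\<in>Poly_Mapping.keys q.
      (Poly_Mapping.lookup p \<alpha> * (\<Prod>i=1..n. x i ^ Poly_Mapping.lookup \<alpha> i)) * (Poly_Mapping.lookup q \<beta> * (\<Prod>i=1..n. x i ^ Poly_Mapping.lookup \<beta> i)))"
    by (subst times_expansion) (simp add: peval_sum peval_single lookup_add power_add prod.distrib mult_ac)
  then show ?thesis by (simp add: peval_def sum_product)
qed

text \<open>The polynomial ring in n variables over \<open>k\<close>, carved out of the polynomials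
  over the whole type because \<open>k\<close> is only a set. Algebraic independence makes
  \<open>peval\<close> injective on this subset.\<close>

definition polys_over :: "'a::field set \<Rightarrow> nat \<Rightarrow> ((nat \<Rightarrow>\<^sub>0 nat) \<Rightarrow>\<^sub>0 'a) set" where
  "polys_over k n = {p. (\<forall>\<alpha>. Poly_Mapping.lookup p \<alpha> \<in> k) \<and>
     (\<forall>\<alpha>\<in>Poly_Mapping.keys p. Poly_Mapping.keys \<alpha> \<subseteq> {1..n})}"

lemma subfield_sum: "is_subfield k \<Longrightarrow> (\<And>i. i \<in> I \<Longrightarrow> f i \<in> k) \<Longrightarrow> sum f I \<in> k"
  by (induction I rule: infinite_finite_induct) (auto simp: is_subfield_def)

context
  fixes k :: "'a::field set" and n :: nat
  assumes k: "is_subfield k"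
begin

lemma polys_over_add: "p \<in> polys_over k n \<Longrightarrow> q \<in> polys_over k n \<Longrightarrow> p + q \<in> polys_over k n"
  using k keys_add[of p q] unfolding polys_over_def is_subfield_def
  by (simp add: lookup_add) blast

lemma polys_over_uminus: "p \<in> polys_over k n \<Longrightarrow> - p \<in> polys_over k n"
  using k unfolding polys_over_def is_subfield_def
  by (simp add: in_keys_iff) (metis diff_0)

lemma polys_over_mult:
  assumes p: "p \<in> polys_over k n" and q: "q \<in> polys_over k n"
  shows "p * q \<in> polys_over k n"
proof -
  have "Poly_Mapping.lookup (p * q) \<gamma> \<in> k" for \<gamma>
    unfolding lookup_times using p q k
    by (intro subfield_sum[OF k]) (auto simp: polys_over_def when_def is_subfield_def)
  moreover have "Poly_Mapping.keys \<gamma> \<subseteq> {1..n}" if \<gamma>: "\<gamma> \<in> Poly_Mapping.keys (p * q)" for \<gamma>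
  proof -
    obtain \<alpha> \<beta> where "\<gamma> = \<alpha> + \<beta>" "\<alpha> \<in> Poly_Mapping.keys p" "\<beta> \<in> Poly_Mapping.keys q"
      using \<gamma> keys_mult[of p q] by auto
    then show ?thesis using p q keys_add[of \<alpha> \<beta>] unfolding polys_over_def by blast
  qed
  ultimately show ?thesis by (simp add: polys_over_def)
qed

lemma polys_over_single:
  "c \<in> k \<Longrightarrow> Poly_Mapping.keys \<alpha> \<subseteq> {1..n} \<Longrightarrow> Poly_Mapping.single \<alpha> c \<in> polys_over k n"
  using k by (auto simp: polys_over_def lookup_single when_def is_subfield_def)

end

text \<open>\<open>alg_indep\<close> speaks of plain functions as exponents, so the exponents of
  \<open>p\<close> are sent through the injective \<open>Poly_Mapping.lookup\<close> and the
  coefficients are read back along its inverse.\<close>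

lemma peval_eq_0:
  assumes ind: "alg_indep k x n" and p: "p \<in> polys_over k n" and z: "peval n x p = 0"
  shows "p = 0"
proof -
  define S where "S = Poly_Mapping.lookup ` Poly_Mapping.keys p"
  define c where "c = (\<lambda>\<alpha>. Poly_Mapping.lookup p (Abs_poly_mapping \<alpha>))"
  have c: "c (Poly_Mapping.lookup \<alpha>) = Poly_Mapping.lookup p \<alpha>" for \<alpha>
    by (simp add: c_def)
  have inj: "inj_on Poly_Mapping.lookup (Poly_Mapping.keys p)" by (auto intro: inj_onI simp: lookup_inject)
  have "(\<Sum>\<alpha>\<in>S. c \<alpha> * (\<Prod>i=1..n. x i ^ \<alpha> i)) = 0"
    unfolding S_def sum.reindex[OF inj] using z by (simp add: c peval_def)
  moreover have "finite S" "S \<subseteq> {\<alpha>. \<forall>i. i \<notin> {1..n} \<longrightarrow> \<alpha> i = 0}" "\<forall>\<alpha>\<in>S. c \<alpha> \<in> k"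
    using p unfolding S_def polys_over_def by (auto simp: c in_keys_iff subset_iff)
  ultimately have "\<forall>\<alpha>\<in>S. c \<alpha> = 0"
    using ind unfolding alg_indep_def by blast
  then have "Poly_Mapping.lookup p \<alpha> = 0" for \<alpha>
    unfolding S_def by (auto simp: c in_keys_iff)
  then show ?thesis by (intro poly_mapping_eqI) simp
qed

text \<open>The fractions of polynomials form a subfield containing \<open>k\<close> and the
  generators, so by minimality they exhaust the field.\<close>

lemma fraction_repr:
  assumes k: "is_subfield k" and ind: "alg_indep k x n" and gen: "generates_field k x n"
  shows "\<exists>p q. p \<in> polys_over k n \<and> q \<in> polys_over k n \<and> q \<noteq> 0 \<and> a = peval n x p / peval n x q"
proof -
  define S where "S = {peval n x p / peval n x q | p q. p \<in> polys_over k n \<and> q \<in> polys_over k n \<and> q \<noteq> 0}"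
  have nz: "peval n x q \<noteq> 0" if "q \<in> polys_over k n" "q \<noteq> 0" for q
    using peval_eq_0[OF ind] that by blast
  have k01: "0 \<in> k" "1 \<in> k" using k by (auto simp: is_subfield_def)
  have one: "1 \<in> polys_over k n" "peval n x 1 = 1" 
    using polys_over_single[OF k, of 1 0 n] peval_single[of n x 0 1] k01 by simp_all
  have I: "peval n x p / peval n x q \<in> S" if "p \<in> polys_over k n" "q \<in> polys_over k n" "q \<noteq> 0" for p q
    using that unfolding S_def by blast
  have emb: "peval n x p \<in> S" if "p \<in> polys_over k n" for p
    using I[OF that one(1)] one(2) by simp
  have "c \<in> S" if "c \<in> k" for c
    using emb[OF polys_over_single[OF k that, of 0]] by (simp add: peval_single)
  then have kS: "k \<subseteq> S" by auto
  have xS: "x ` {1..n} \<subseteq> S"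
  proof safe
    fix i assume i: "i \<in> {1..n}"
    show "x i \<in> S"
      using peval_var[OF i, of x] emb[OF polys_over_single[OF k k01(2), of "Poly_Mapping.single i 1"]] i by simp
  qed
  have "is_subfield S"
    unfolding is_subfield_def
  proof (intro conjI ballI)
    show "0 \<in> S" "1 \<in> S" using kS k01 by auto
    fix a assume "a \<in> S"
    then obtain p q where a: "p \<in> polys_over k n" "q \<in> polys_over k n" "q \<noteq> 0"
        "a = peval n x p / peval n x q"
      unfolding S_def by blast
    \<comment> \<open>If the numerator is 0 then so is the element, and its inverse is 0 by
      convention.\<close>
    show "inverse a \<in> S"
      using I[OF a(2,1)] a(4) \<open>0 \<in> S\<close> by (cases "p = 0") (auto simp: peval_0)
    fix b assume "b \<in> S"
    then obtain p' q' where b: "p' \<in> polys_over k n" "q' \<in> polys_over k n" "q' \<noteq> 0"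
        "b = peval n x p' / peval n x q'"
      unfolding S_def by blast
    have qq: "q * q' \<in> polys_over k n" "q * q' \<noteq> 0"
      using a b polys_over_mult[OF k] by auto
    note nz_den = nz[OF a(2,3)] nz[OF b(2,3)]
    have "a + b = peval n x (p * q' + p' * q) / peval n x (q * q')"
      unfolding a(4) b(4) peval_add peval_mult using nz_den by (simp add: field_simps)
    then show "a + b \<in> S"
      using I[OF _ qq] a b polys_over_mult[OF k] polys_over_add[OF k] by simp
    have "a - b = peval n x (p * q' + - (p' * q)) / peval n x (q * q')"
      unfolding a(4) b(4) peval_add peval_uminus peval_mult using nz_den by (simp add: field_simps)
    then show "a - b \<in> S"
      using I[OF polys_over_add[OF k polys_over_mult[OF k] polys_over_uminus[OF k polys_over_mult[OF k]]] qq] a b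
      by simp
    have "a * b = peval n x (p * p') / peval n x (q * q')"
      using a b by (simp add: peval_mult)
    then show "a * b \<in> S"
      using I[OF _ qq] a b polys_over_mult[OF k] by simp
  qed
  then have "S = UNIV" using gen kS xS unfolding generates_field_def by blast
  then show ?thesis unfolding S_def by blast
qed

section \<open>Parity classes of field elements\<close>

definition parity_vec :: "(nat \<Rightarrow>\<^sub>0 nat) \<Rightarrow> nat \<Rightarrow> bit" where
  "parity_vec \<alpha> = (\<lambda>i. of_nat (Poly_Mapping.lookup \<alpha> i))"

lemma parity_vec_add: "parity_vec (\<alpha> + \<beta>) = parity_vec \<alpha> + parity_vec \<beta>"
  by (simp add: parity_vec_def lookup_add fun_eq_iff)

lemma add_self_bit_fun: "v + v = (0 :: 'i \<Rightarrow> bit)"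
  by (simp add: fun_eq_iff)

text \<open>This extracts what is needed from the monomial valuation. Over a common denominator,
  different classes force different leading exponents of the numerators, so the leading term of a
  sum is that of one of its summands.\<close>

lemma leading_parity_exists:
  fixes x :: "nat \<Rightarrow> 'a::field"
  assumes k: "is_subfield k" and ind: "alg_indep k x n" and gen: "generates_field k x n"
  obtains cls :: "'a \<Rightarrow> nat \<Rightarrow> bit"
  where "\<And>a b. a \<noteq> 0 \<Longrightarrow> b \<noteq> 0 \<Longrightarrow> cls (a * b) = cls a + cls b"
    and "\<And>a b. a \<noteq> 0 \<Longrightarrow> b \<noteq> 0 \<Longrightarrow> cls a \<noteq> cls b \<Longrightarrow> cls (a + b) \<in> {cls a, cls b}"
    and "\<And>i. i \<in> {1..n} \<Longrightarrow> cls (x i) = (\<lambda>j. of_bool (j = i))"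
    and "\<And>i. i \<in> {1..n} \<Longrightarrow> x i \<noteq> 0"
proof -
  define P where "P = polys_over k n"
  have PI: "p * q \<in> P" "p + q \<in> P" if "p \<in> P" "q \<in> P" for p q
    using that polys_over_mult[OF k] polys_over_add[OF k] unfolding P_def by auto
  have nz: "peval n x q \<noteq> 0" if "q \<in> P" "q \<noteq> 0" for q
    using peval_eq_0[OF ind] that unfolding P_def by blast
  have inj: "p = q" if "p \<in> P" "q \<in> P" "peval n x p = peval n x q" for p q
  proof -
    have "p + - q = 0"
      using that polys_over_add[OF k] polys_over_uminus[OF k]
      by (intro peval_eq_0[OF ind]) (auto simp: P_def peval_add peval_uminus simp del: add_uminus_conv_diff)
    then show ?thesis by simp
  qed
  have "\<forall>a. \<exists>pq. fst pq \<in> P \<and> snd pq \<in> P \<and> snd pq \<noteq> 0 \<and>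
      a = peval n x (fst pq) / peval n x (snd pq)"
    using fraction_repr[OF k ind gen] unfolding P_def by auto
  then obtain f where f: "\<forall>a. fst (f a) \<in> P \<and> snd (f a) \<in> P \<and> snd (f a) \<noteq> 0 \<and>
      a = peval n x (fst (f a)) / peval n x (snd (f a))"
    by (rule exE[OF choice])
  define num where "num = fst \<circ> f"
  define den where "den = snd \<circ> f"
  have nd: "num a \<in> P" "den a \<in> P" "den a \<noteq> 0"
      "peval n x (num a) / peval n x (den a) = a" for a
    using f by (simp_all add: num_def den_def)
  have num0: "num a \<noteq> 0" if "a \<noteq> 0" for a
    using nd(4)[of a] that by (auto simp: peval_0)
  \<comment> \<open>The class is defined by a chosen fraction, and independence of the choice is
    shown afterwards. The difference of exponents belonging to a quotient is a sum modulo 2.\<close>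
  define cls where "cls a = parity_vec (lead (num a)) + parity_vec (lead (den a))" for a
  have cancel: "u + w = v + z" if "u + z = v + w" for u v w z :: "nat \<Rightarrow> bit"
  proof
    fix i
    have "u i + z i = v i + w i" using that by (metis plus_fun_apply)
    then show "(u + w) i = (v + z) i"
      by (cases "u i"; cases "v i"; cases "w i"; cases "z i") simp_all
  qed
  \<comment> \<open>Two fractions for one element are cross-multiplied; injectivity of
    \<open>peval\<close> turns this into an identity of polynomials, to which
    \<open>lead_mult\<close> applies.\<close>
  have cls: "cls a = parity_vec (lead p) + parity_vec (lead q)"
    if "p \<in> P" "q \<in> P" "q \<noteq> 0" "a \<noteq> 0" "a = peval n x p / peval n x q" for a p q
  proof -
    have p0: "p \<noteq> 0" using that by (auto simp: peval_0)
    have "peval n x (num a * q) = peval n x (p * den a)"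
      using trans[OF nd(4) that(5)] nz[OF that(2,3)] nz[OF nd(2,3), of a]
      by (simp add: peval_mult frac_eq_eq)
    then have "num a * q = p * den a" by (intro inj PI that(1,2) nd(1,2))
    then have "lead (num a) + lead q = lead p + lead (den a)"
      using lead_mult[of "num a" q] lead_mult[of p "den a"] num0[OF that(4)] nd(3) p0 that(3) by simp
    then have "parity_vec (lead (num a)) + parity_vec (lead q) = parity_vec (lead p) + parity_vec (lead (den a))"
      by (metis parity_vec_add)
    from cancel[OF this] show ?thesis unfolding cls_def .
  qed
  show ?thesis
  proof
    fix a b :: 'a assume ab: "a \<noteq> 0" "b \<noteq> 0"
    have nz_den: "peval n x (den c) \<noteq> 0" for c using nz nd(2,3) by blast
    have num_eq: "peval n x (num c) = c * peval n x (den c)" for c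
      using nd(4)[of c] nz_den[of c] by (simp add: divide_eq_eq)
    have num_den0: "num a \<noteq> 0" "num b \<noteq> 0" "den a \<noteq> 0" "den b \<noteq> 0"
      using num0 ab nd(3) by blast+
    \<comment> \<open>With the common denominator \<open>?d\<close>, a is \<open>?p / ?d\<close> and
      b is \<open>?q / ?d\<close>, so the classes differ only through the numerators.\<close>
    let ?p = "num a * den b" and ?q = "num b * den a" and ?d = "den a * den b"
    have d: "?d \<in> P" "?d \<noteq> 0" using PI nd(2) num_den0 by simp_all
    have "cls (a * b) = parity_vec (lead (num a * num b)) + parity_vec (lead ?d)"
      using ab nz_den by (intro cls d PI nd(1)) (simp_all add: peval_mult num_eq)
    then show "cls (a * b) = cls a + cls b"
      using num_den0 by (simp add: lead_mult parity_vec_add cls_def add_ac)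
    assume ne: "cls a \<noteq> cls b"
    have A: "cls a = parity_vec (lead ?p) + parity_vec (lead ?d)"
      using ab nz_den by (intro cls d PI nd(1,2)) (simp_all add: peval_mult num_eq)
    have B: "cls b = parity_vec (lead ?q) + parity_vec (lead ?d)"
      using ab nz_den by (intro cls d PI nd(1,2)) (simp_all add: peval_mult num_eq)
    have lead_ne: "lead ?p \<noteq> lead ?q" using A B ne by auto
    have sum: "peval n x (?p + ?q) = (a + b) * peval n x ?d"
      by (simp add: peval_add peval_mult num_eq algebra_simps)
    \<comment> \<open>Otherwise \<open>?p\<close> would be the negative of \<open>?q\<close>, and
      opposite polynomials have the same leading exponent.\<close>
    have "a + b \<noteq> 0"
    proof
      assume "a + b = 0"
      then have "?p + ?q = 0"
        using sum inj[of "?p + ?q" 0] peval_eq_0[OF ind, of "?p + ?q"] PI nd(1,2) by (simp add: P_def)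
      then have "?p = - ?q" by (simp add: add_eq_0_iff2)
      then have "lead ?p = lead ?q" by (simp add: lead_def in_keys_iff Poly_Mapping.keys.rep_eq)
      then show False using lead_ne by simp
    qed
    then have "cls (a + b) = parity_vec (lead (?p + ?q)) + parity_vec (lead ?d)"
      using nz[OF d] by (intro cls d PI nd(1,2)) (simp_all add: sum)
    moreover have "lead (?p + ?q) \<in> {lead ?p, lead ?q}"
      using lead_ne num_den0 by (intro lead_add) simp_all
    ultimately show "cls (a + b) \<in> {cls a, cls b}" using A B by auto
  next
    fix i assume i: "i \<in> {1..n}"
    let ?p = "Poly_Mapping.single (Poly_Mapping.single i 1) 1 :: (nat \<Rightarrow>\<^sub>0 nat) \<Rightarrow>\<^sub>0 'a"
    have k1: "1 \<in> k" using k by (simp add: is_subfield_def)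
    have pP: "?p \<in> P" "1 \<in> P"
      using polys_over_single[OF k k1, of "Poly_Mapping.single i 1"]
        polys_over_single[OF k k1, of 0] i unfolding P_def by auto
    have px: "peval n x ?p = x i" by (rule peval_var[OF i])
    have "peval n x 1 = 1" using peval_single[of n x 0 1] by simp
    moreover show x0: "x i \<noteq> 0" using nz[OF pP(1)] px
      by (metis lookup_single_eq lookup_zero zero_neq_one)
    ultimately have "cls (x i) = parity_vec (lead ?p) + parity_vec (lead (1 :: (nat \<Rightarrow>\<^sub>0 nat) \<Rightarrow>\<^sub>0 'a))"
      using pP px by (intro cls) auto
    then show "cls (x i) = (\<lambda>j. of_bool (j = i))"
      by (simp add: lead_def parity_vec_def fun_eq_iff lookup_single when_def)
  qed
qed

section \<open>Isometries of diagonal forms\<close>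

text \<open>Three pairwise sums equal to 0 would give \<open>2 * d p = 0\<close>. With just two
  indices the pair sum is the total, and a nonzero total rules out the empty set.\<close>

lemma exists_pair_sum_nonzero:
  fixes d :: "'i \<Rightarrow> 'a::field"
  assumes two: "(2::'a) \<noteq> 0" and S: "finite S" "card S \<noteq> 1"
    and d: "\<And>i. i \<in> S \<Longrightarrow> d i \<noteq> 0" and sum: "sum d S \<noteq> 0"
  shows "\<exists>i\<in>S. \<exists>j\<in>S. i \<noteq> j \<and> d i + d j \<noteq> 0"
proof (rule ccontr)
  assume "\<not> ?thesis"
  then have 0: "d i + d j = 0" if "i \<in> S" "j \<in> S" "i \<noteq> j" for i j using that by blast
  obtain p where p: "p \<in> S" using sum by (metis sum.empty equals0I)
  obtain q where q: "q \<in> S" "q \<noteq> p"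
  proof -
    have "S \<noteq> {p}" using S(2) by auto
    then show ?thesis using p that by blast
  qed
  show False
  proof (cases "S = {p, q}")
    case True
    then show False using sum q 0[of p q] by auto
  next
    case False
    then obtain r where r: "r \<in> S" "r \<noteq> p" "r \<noteq> q" using p q by blast
    have "2 * d p = (d p + d q) + (d p + d r) - (d q + d r)" by (simp add: algebra_simps)
    also have "\<dots> = 0" using 0[of p q] 0[of p r] 0[of q r] p q r by simp
    finally show False using two d[OF p] by simp
  qed
qed

text \<open>In a plane with orthogonal vectors of norms \<open>a1\<close> and \<open>a2\<close>, the
  vector (\<open>c1\<close>, \<open>c2\<close>) has norm \<open>s\<close>, and
  (\<open>- a2 * c2\<close>, \<open>a1 * c1\<close>) is orthogonal to it with norm
  \<open>a1 * a2 * s\<close>. The quotients are the coordinates of y and z in this new basis; the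
  bilinear form is the same in both bases.\<close>

lemma binary_orthogonal_change:
  fixes a1 a2 c1 c2 :: "'a::field"
  assumes s: "s = a1 * c1\<^sup>2 + a2 * c2\<^sup>2" "s \<noteq> 0"
  shows "s * ((a1 * c1 * y1 + a2 * c2 * y2) / s) * ((a1 * c1 * z1 + a2 * c2 * z2) / s) +
    a1 * a2 * s * ((c1 * y2 - c2 * y1) / s) * ((c1 * z2 - c2 * z1) / s) = a1 * y1 * z1 + a2 * y2 * z2"
    (is "?l = ?r")
proof -
  have "?l * s = (a1 * c1 * y1 + a2 * c2 * y2) * (a1 * c1 * z1 + a2 * c2 * z2)
      + a1 * a2 * (c1 * y2 - c2 * y1) * (c1 * z2 - c2 * z1)"
    using s(2) by (simp add: field_simps)
  also have "\<dots> = ?r * s" unfolding s(1) by (simp add: algebra_simps power2_eq_square)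
  finally show ?thesis using s(2) by simp
qed

text \<open>The column \<open>C _ j\<close> holds the coordinates of one orthogonal basis with respect to another;
  the basis change is a chain of changes of two vectors at a time, each of which shortens
  the expansion of a fixed vector of the new basis.\<close>

lemma sum_orthogonal_basis_invariant:
  fixes \<phi> :: "'a::field \<Rightarrow> 'g::comm_monoid_add" and a :: "'i \<Rightarrow> 'a" and b :: "'j \<Rightarrow> 'a"
  assumes two: "(2::'a) \<noteq> 0"
    and sq: "\<And>a s. a \<noteq> 0 \<Longrightarrow> s \<noteq> 0 \<Longrightarrow> \<phi> (a * s\<^sup>2) = \<phi> a"
    and binary: "\<And>a b. a \<noteq> 0 \<Longrightarrow> b \<noteq> 0 \<Longrightarrow> a + b \<noteq> 0 \<Longrightarrow> \<phi> a + \<phi> b = \<phi> (a + b) + \<phi> (a * b * (a + b))"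
    and "finite I" "finite J" "card I = card J"
    and "\<And>i. i \<in> I \<Longrightarrow> a i \<noteq> 0" "\<And>j. j \<in> J \<Longrightarrow> b j \<noteq> 0"
    and "\<And>j k. j \<in> J \<Longrightarrow> k \<in> J \<Longrightarrow> (\<Sum>i\<in>I. a i * C i j * C i k) = (if j = k then b j else 0)"
  shows "(\<Sum>i\<in>I. \<phi> (a i)) = (\<Sum>j\<in>J. \<phi> (b j))"
  using assms(4-)
proof (induction "card J" arbitrary: I J a C)
  case 0
  then show ?case by simp
next
  case (Suc m)
  then obtain j0 where j0: "j0 \<in> J" by (metis card.empty equals0I nat.distinct(1))
  \<comment> \<open>The outer induction is on the dimension, the inner one on the number of nonzero
    coordinates of the fixed new basis vector \<open>j0\<close>.\<close>
  show ?case
    using Suc.prems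
  proof (induction "card {i\<in>I. C i j0 \<noteq> 0}" arbitrary: a C rule: less_induct)
    case less
    define S where "S = {i\<in>I. C i j0 \<noteq> 0}"
    have S: "finite S" "S \<subseteq> I" using less.prems(1) by (auto simp: S_def)
    have "(\<Sum>i\<in>S. a i * (C i j0)\<^sup>2) = (\<Sum>i\<in>I. a i * C i j0 * C i j0)"
      using less.prems(1) unfolding S_def
      by (intro sum.mono_neutral_cong_left) (auto simp: power2_eq_square)
    also have "\<dots> = b j0" using less.prems(6) j0 by simp
    finally have bj0: "(\<Sum>i\<in>S. a i * (C i j0)\<^sup>2) = b j0" .
    show ?case
    proof (cases "card S = 1")
      case True
      then obtain i0 where i0: "S = {i0}" by (rule card_1_singletonE)
      have i0I: "i0 \<in> I" "C i0 j0 \<noteq> 0" using i0 unfolding S_def by auto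
      \<comment> \<open>Vector \<open>j0\<close> is a multiple of the old vector \<open>i0\<close>.
        Orthogonality to it removes coordinate \<open>i0\<close> from all other columns, so the two
        vectors can be split off.\<close>
      have zero: "C i0 k = 0" if "k \<in> J" "k \<noteq> j0" for k
      proof -
        have "a i0 * C i0 j0 * C i0 k = (\<Sum>i\<in>S. a i * C i j0 * C i k)" by (simp add: i0)
        also have "\<dots> = (\<Sum>i\<in>I. a i * C i j0 * C i k)"
          using less.prems(1) unfolding S_def by (intro sum.mono_neutral_left) auto
        also have "\<dots> = 0" using less.prems(6) j0 that by simp
        finally show ?thesis using i0I less.prems(4) by simp
      qed
      have "(\<Sum>i\<in>I - {i0}. \<phi> (a i)) = (\<Sum>j\<in>J - {j0}. \<phi> (b j))"
      proof (rule Suc.hyps(1)[where C = C])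
        show "m = card (J - {j0})" "finite (I - {i0})" "finite (J - {j0})"
            "card (I - {i0}) = card (J - {j0})"
          using Suc.hyps(2) j0 less.prems(1-3) i0I by simp_all
        fix j k assume jk: "j \<in> J - {j0}" "k \<in> J - {j0}"
        have "(\<Sum>i\<in>I - {i0}. a i * C i j * C i k) = (\<Sum>i\<in>I. a i * C i j * C i k)"
          using less.prems(1) zero jk by (intro sum.mono_neutral_left) auto
        then show "(\<Sum>i\<in>I - {i0}. a i * C i j * C i k) = (if j = k then b j else 0)"
          using less.prems(6) jk by simp
      qed (use less.prems in auto)
      moreover have "\<phi> (b j0) = \<phi> (a i0)"
        using bj0 sq less.prems(4) i0I by (simp add: i0 flip: bj0)
      ultimately show ?thesis
        using sum.remove[OF less.prems(1) i0I(1), of "\<lambda>i. \<phi> (a i)"]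
          sum.remove[OF less.prems(2) j0, of "\<lambda>j. \<phi> (b j)"] by simp
    next
      case False
      have "\<exists>i\<in>S. \<exists>j\<in>S. i \<noteq> j \<and> a i * (C i j0)\<^sup>2 + a j * (C j j0)\<^sup>2 \<noteq> 0"
      proof (rule exists_pair_sum_nonzero[OF two S(1) False])
        show "(\<Sum>i\<in>S. a i * (C i j0)\<^sup>2) \<noteq> 0"
          using bj0 less.prems(5) j0 by simp
      qed (use less.prems(4) in \<open>auto simp: S_def\<close>)
      then obtain i1 i2 where i12: "i1 \<in> S" "i2 \<in> S" "i1 \<noteq> i2"
        and s0: "a i1 * (C i1 j0)\<^sup>2 + a i2 * (C i2 j0)\<^sup>2 \<noteq> 0" by blast
      define s where "s = a i1 * (C i1 j0)\<^sup>2 + a i2 * (C i2 j0)\<^sup>2"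
      have s: "s \<noteq> 0" using s0 by (simp add: s_def)
      \<comment> \<open>The old vectors \<open>i1\<close>, \<open>i2\<close> give way to the
        component of vector \<open>j0\<close> in their plane, of norm \<open>s\<close>, and to a
        vector of that plane orthogonal to it. Vector \<open>j0\<close> then has coordinates 1 and 0
        there, so its support shrinks.\<close>
      define a' where "a' = a(i1 := s, i2 := a i1 * a i2 * s)"
      define C' where "C' i k =
        (if i = i1 then (a i1 * C i1 j0 * C i1 k + a i2 * C i2 j0 * C i2 k) / s
         else if i = i2 then (C i1 j0 * C i2 k - C i2 j0 * C i1 k) / s else C i k)" for i k
      have nz: "a i1 \<noteq> 0" "a i2 \<noteq> 0" "C i1 j0 \<noteq> 0" "C i2 j0 \<noteq> 0" "i1 \<in> I" "i2 \<in> I"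
        using i12 less.prems(4) by (auto simp: S_def)
      have split: "sum f I = f i1 + f i2 + sum f (I - {i1, i2})"
        for f :: "'i \<Rightarrow> 'b::comm_monoid_add"
        using sum.subset_diff[of "{i1, i2}" I f] nz less.prems(1) i12(3) by (simp add: add.commute)
      have "(\<Sum>i\<in>I. \<phi> (a i)) = (\<Sum>i\<in>I. \<phi> (a' i))"
      proof -
        have "\<phi> (a i1) + \<phi> (a i2) = \<phi> (a i1 * (C i1 j0)\<^sup>2) + \<phi> (a i2 * (C i2 j0)\<^sup>2)"
          using nz sq by simp
        also have "\<dots> = \<phi> s + \<phi> (a i1 * (C i1 j0)\<^sup>2 * (a i2 * (C i2 j0)\<^sup>2) * s)"
          using nz s unfolding s_def by (intro binary) auto
        also have "a i1 * (C i1 j0)\<^sup>2 * (a i2 * (C i2 j0)\<^sup>2) * s = (a i1 * a i2 * s) * (C i1 j0 * C i2 j0)\<^sup>2"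
          by (simp add: power_mult_distrib mult_ac)
        also have "\<phi> \<dots> = \<phi> (a i1 * a i2 * s)" using nz s by (intro sq) auto
        finally show ?thesis
          unfolding split using i12(3) by (simp add: a'_def)
      qed
      also have "\<dots> = (\<Sum>j\<in>J. \<phi> (b j))"
      proof (rule less.hyps[where C = C'])
        have "C' i1 j0 = 1" "C' i2 j0 = 0"
          using i12(3) s by (simp_all add: C'_def s_def power2_eq_square mult_ac)
        then have "{i \<in> I. C' i j0 \<noteq> 0} \<subseteq> S - {i2}"
          using i12 by (auto simp: S_def C'_def split: if_splits)
        then have "card {i \<in> I. C' i j0 \<noteq> 0} \<le> card (S - {i2})"
          using S(1) by (intro card_mono) auto
        also have "\<dots> < card S" using S(1) i12(2) by (rule card_Diff1_less)
        finally show "card {i \<in> I. C' i j0 \<noteq> 0} < card {i \<in> I. C i j0 \<noteq> 0}"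
          by (simp add: S_def)
        show "a' i \<noteq> 0" if "i \<in> I" for i
          using that less.prems(4) nz s by (auto simp: a'_def)
        fix j k assume jk: "j \<in> J" "k \<in> J"
        have "(\<Sum>i\<in>I. a' i * C' i j * C' i k) = (\<Sum>i\<in>I. a i * C i j * C i k)"
        proof -
          have 1: "a' i1 = s" "a' i2 = a i1 * a i2 * s"
            "C' i1 l = (a i1 * C i1 j0 * C i1 l + a i2 * C i2 j0 * C i2 l) / s"
            "C' i2 l = (C i1 j0 * C i2 l - C i2 j0 * C i1 l) / s" for l
            using i12(3) by (simp_all add: a'_def C'_def)
          have 2: "(\<Sum>i\<in>I - {i1, i2}. a' i * C' i j * C' i k) = (\<Sum>i\<in>I - {i1, i2}. a i * C i j * C i k)"
            by (intro sum.cong) (auto simp: a'_def C'_def)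
          show ?thesis
            unfolding split 2 unfolding 1 binary_orthogonal_change[OF s_def s] ..
        qed
        then show "(\<Sum>i\<in>I. a' i * C' i j * C' i k) = (if j = k then b j else 0)"
          using less.prems(6) jk by simp
      qed (use less.prems in auto)
      finally show ?thesis .
    qed
  qed
qed

lemma sum_lessThan_length_nth: "(\<Sum>i<length xs. f (xs ! i)) = sum_list (map f xs)"
  by (simp add: sum_list_sum_nth atLeast0LessThan)

text \<open>The columns of \<open>P\<close> are an orthogonal basis whose norms are the entries of
  \<open>b\<close>. Their Gram matrix \<open>D\<close> is found by evaluating at unit vectors and,
  by polarization in characteristic not 2, at sums of two of them.\<close>

lemma isometric_imp_sum_list_eq:
  fixes \<phi> :: "'a::field \<Rightarrow> 'g::comm_monoid_add"
  assumes two: "(2::'a) \<noteq> 0"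
    and sq: "\<And>a s. a \<noteq> 0 \<Longrightarrow> s \<noteq> 0 \<Longrightarrow> \<phi> (a * s\<^sup>2) = \<phi> a"
    and binary: "\<And>a b. a \<noteq> 0 \<Longrightarrow> b \<noteq> 0 \<Longrightarrow> a + b \<noteq> 0 \<Longrightarrow> \<phi> a + \<phi> b = \<phi> (a + b) + \<phi> (a * b * (a + b))"
    and nd: "nondeg a" "nondeg b" and iso: "isometric a b"
  shows "sum_list (map \<phi> a) = sum_list (map \<phi> b)"
proof -
  obtain P where len: "length a = length b"
    and P: "\<And>v. qf_val a (\<lambda>i. \<Sum>j<length a. P i j * v j) = qf_val b v"
    using iso unfolding isometric_def by blast
  define D where "D j k = (\<Sum>i<length a. a ! i * P i j * P i k)" for j k
  define e where "e j = (\<lambda>i. if i = j then 1 else (0::'a))" for j :: nat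
  have diag: "D j j = b ! j" if "j < length a" for j
  proof -
    have "qf_val a (\<lambda>i. \<Sum>l<length a. P i l * e j l) = D j j"
      using that by (simp add: qf_val_def e_def D_def power2_eq_square mult_ac if_distrib[of "(*) _"] cong: if_cong)
    moreover have "qf_val b (e j) = (\<Sum>l<length b. if l = j then b ! l else 0)"
      unfolding qf_val_def by (intro sum.cong) (auto simp: e_def)
    ultimately show ?thesis using P[of "e j"] that len by simp
  qed
  have off: "D j k = 0" if "j < length a" "k < length a" "j \<noteq> k" for j k
  proof -
    have sum_e: "(\<Sum>l<length a. P i l * (e j l + e k l)) = P i j + P i k" for i
      using that by (simp add: e_def distrib_left sum.distrib if_distrib[of "(*) _"] cong: if_cong)
    have "qf_val a (\<lambda>i. \<Sum>l<length a. P i l * (e j l + e k l)) = D j j + D k k + 2 * D j k"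
      unfolding sum_e by (simp add: qf_val_def D_def power2_eq_square algebra_simps sum.distrib sum_distrib_left)
    moreover have "qf_val b (\<lambda>l. e j l + e k l) =
        (\<Sum>l<length b. (if l = j then b ! l else 0) + (if l = k then b ! l else 0))"
      unfolding qf_val_def using that by (intro sum.cong) (auto simp: e_def)
    then have "qf_val b (\<lambda>l. e j l + e k l) = b ! j + b ! k"
      using that len by (simp add: sum.distrib)
    ultimately show ?thesis
      using P[of "\<lambda>l. e j l + e k l"] two diag that by simp
  qed
  have "(\<Sum>i<length a. \<phi> (a ! i)) = (\<Sum>j<length b. \<phi> (b ! j))"
    using nd len diag off unfolding D_def nondeg_def
    by (intro sum_orthogonal_basis_invariant[OF two sq binary, where C = P]) auto
  then show ?thesis by (simp add: sum_lessThan_length_nth)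
qed

section \<open>Building isometries and discarding hyperbolic planes\<close>

lemma isometric_trans [trans]:
  assumes "isometric a b" "isometric b c"
  shows "isometric a c"
proof -
  define m where "m = length a"
  obtain P Q where len: "length b = m"
    and PQ: "\<forall>i<m. \<forall>j<m. (\<Sum>l<m. P i l * Q l j) = (if i = j then 1 else 0)"
    and P: "\<forall>v. qf_val a (\<lambda>i. \<Sum>j<m. P i j * v j) = qf_val b v"
    using assms(1) unfolding m_def isometric_def by (elim conjE exE) simp
  obtain R T where len': "length c = m"
    and RT: "\<forall>i<m. \<forall>j<m. (\<Sum>l<m. R i l * T l j) = (if i = j then 1 else 0)"
    and R: "\<forall>v. qf_val b (\<lambda>i. \<Sum>j<m. R i j * v j) = qf_val c v"
    using assms(2) unfolding len[symmetric] isometric_def by (elim conjE exE) simp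
  \<comment> \<open>The inverse of the product of \<open>P\<close> and \<open>R\<close> is the
    product of their inverses in reverse order.\<close>
  let ?X = "\<lambda>i j. \<Sum>l<m. P i l * R l j" and ?Y = "\<lambda>i j. \<Sum>l<m. T i l * Q l j"
  have "(\<Sum>l<m. ?X i l * ?Y l j) = (if i = j then 1 else 0)" if "i < m" "j < m" for i j
  proof -
    have "(\<Sum>l<m. ?X i l * ?Y l j) = (\<Sum>l<m. \<Sum>p<m. \<Sum>q<m. P i p * (R p l * T l q) * Q q j)"
      by (simp only: sum_product mult.assoc)
    also have "\<dots> = (\<Sum>p<m. \<Sum>q<m. \<Sum>l<m. P i p * (R p l * T l q) * Q q j)"
      by (rule trans[OF sum.swap], rule sum.cong, rule refl, rule sum.swap)
    also have "\<dots> = (\<Sum>p<m. \<Sum>q<m. P i p * (\<Sum>l<m. R p l * T l q) * Q q j)"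
      by (simp add: sum_distrib_left sum_distrib_right)
    also have "\<dots> = (\<Sum>p<m. \<Sum>q<m. if p = q then P i p * Q q j else 0)"
      using RT by (intro sum.cong) auto
    also have "\<dots> = (\<Sum>p<m. P i p * Q p j)" by simp
    finally show ?thesis using PQ that by simp
  qed
  moreover have "qf_val a (\<lambda>i. \<Sum>j<m. ?X i j * v j) = qf_val c v" for v
  proof -
    have "(\<Sum>j<m. ?X i j * v j) = (\<Sum>l<m. P i l * (\<Sum>j<m. R l j * v j))" for i
      unfolding sum_distrib_left sum_distrib_right mult.assoc by (rule sum.swap)
    then show ?thesis by (simp add: P R)
  qed
  ultimately show ?thesis
    unfolding isometric_def m_def[symmetric] len'
    by (intro conjI exI[of _ ?X] exI[of _ ?Y]) auto
qed

lemma isometric_Cons: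
  assumes "isometric a b"
  shows "isometric (c # a) (c # b)"
proof -
  define m where "m = length a"
  obtain P Q where len: "length b = m"
    and PQ: "\<forall>i<m. \<forall>j<m. (\<Sum>l<m. P i l * Q l j) = (if i = j then 1 else 0)"
    and P: "\<forall>v. qf_val a (\<lambda>i. \<Sum>j<m. P i j * v j) = qf_val b v"
    using assms(1) unfolding m_def isometric_def by (elim conjE exE) simp
  \<comment> \<open>Block matrix: a corner entry 1 for the new first variable, and \<open>M\<close>
    for the others.\<close>
  define ext where "ext M i j = (case i of 0 \<Rightarrow> (case j of 0 \<Rightarrow> 1 | Suc _ \<Rightarrow> 0)
      | Suc i' \<Rightarrow> (case j of 0 \<Rightarrow> 0 | Suc j' \<Rightarrow> M i' j'))" for M :: "nat \<Rightarrow> nat \<Rightarrow> 'a" and i j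
  have "(\<Sum>l<Suc m. ext P i l * ext Q l j) = (if i = j then 1 else 0)"
    if "i < Suc m" "j < Suc m" for i j
    using that PQ
    by (cases i; cases j) (simp_all add: sum.lessThan_Suc_shift ext_def del: sum.lessThan_Suc)
  moreover have "qf_val (c # a) (\<lambda>i. \<Sum>j<Suc m. ext P i j * v j) = qf_val (c # b) v" for v
    using spec[OF P, of "\<lambda>i. v (Suc i)"] len
    by (simp add: qf_val_def sum.lessThan_Suc_shift ext_def m_def del: sum.lessThan_Suc)
  ultimately show ?thesis
    unfolding isometric_def using len
    by (intro conjI exI[of _ "ext P"] exI[of _ "ext Q"]) (auto simp: m_def)
qed

lemma isometric_append: "isometric a b \<Longrightarrow> isometric (c @ a) (c @ b)"
  by (induction c) (auto intro: isometric_Cons)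

lemma isometric_mset:
  assumes "mset a = mset b"
  shows "isometric a b"
proof -
  obtain p where p: "p permutes {..<length b}" "permute_list p b = a"
    using assms by (rule mset_eq_permutation)
  define m where "m = length b"
  have len: "length a = m" using p by (auto simp: m_def)
  \<comment> \<open>The permutation matrix of \<open>p\<close> and its transpose.\<close>
  let ?P = "\<lambda>i j. if j = p i then 1 else (0::'a)" and ?Q = "\<lambda>i j. if i = p j then 1 else (0::'a)"
  have pm: "p i < m \<longleftrightarrow> i < m" for i using permutes_in_image[OF p(1)] by (simp add: m_def)
  have "(\<Sum>l<m. ?P i l * ?Q l j) = (if i = j then 1 else 0)" if "i < m" "j < m" for i j
  proof -
    have "(\<Sum>l<m. ?P i l * ?Q l j) = (\<Sum>l<m. if l = p i then (if p i = p j then 1 else 0) else 0)"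
      by (intro sum.cong) auto
    also have "\<dots> = (if p i = p j then 1 else 0)" using that pm by simp
    also have "\<dots> = (if i = j then 1 else 0)" using permutes_inj[OF p(1)] by (simp add: inj_eq)
    finally show ?thesis .
  qed
  moreover have "qf_val a (\<lambda>i. \<Sum>j<m. ?P i j * v j) = qf_val b v" for v
  proof -
    have "(\<Sum>j<m. ?P i j * v j) = v (p i)" if "i < m" for i
    proof -
      have "(\<Sum>j<m. ?P i j * v j) = (\<Sum>j<m. if j = p i then v j else 0)"
        by (intro sum.cong) auto
      then show ?thesis using that pm by simp
    qed
    then have "qf_val a (\<lambda>i. \<Sum>j<m. ?P i j * v j) = (\<Sum>i<m. b ! p i * (v (p i))\<^sup>2)"
      unfolding qf_val_def len using p m_def
      by (intro sum.cong) (auto simp: permute_list_nth[OF p(1), symmetric])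
    also have "\<dots> = (\<Sum>i<m. b ! i * (v i)\<^sup>2)"
      using sum.permute[OF p(1), of "\<lambda>i. b ! i * (v i)\<^sup>2"] by (simp add: m_def o_def)
    finally show ?thesis by (simp add: qf_val_def m_def)
  qed
  ultimately show ?thesis
    unfolding isometric_def len by (intro conjI exI[of _ ?P] exI[of _ ?Q]) (auto simp: m_def)
qed

text \<open>A square root of -1 splits \<open>c * (v 0)^2 + c * (v 1)^2\<close> into two linear
  factors, just as \<open>X^2 - Y^2\<close> splits; matching the factors gives the isometry.\<close>

lemma isometric_hyperbolic_plane:
  fixes c i :: "'a::field"
  assumes two: "(2::'a) \<noteq> 0" and i: "i * i = -1" and c: "c \<noteq> 0"
  shows "isometric [1, -1] [c, c]"
proof -
  define h where "h = 1 / (2::'a)"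
  define d where "d = 1 / c"
  have h: "2 * h = 1" and d: "c * d = 1" using two c by (simp_all add: h_def d_def)
  \<comment> \<open>\<open>P\<close> solves \<open>X + Y = c * (v 0 + i * v 1)\<close> and
    \<open>X - Y = v 0 - i * v 1\<close> for X and Y, with \<open>h\<close> one half.
    \<open>Q\<close> is the inverse matrix, written with \<open>d\<close> as the inverse of
    \<open>c\<close>.\<close>
  define P where "P r s =
    (if r = (0::nat) then (if s = (0::nat) then (c + 1) * h else i * (c - 1) * h)
     else (if s = 0 then (c - 1) * h else i * (c + 1) * h))" for r s
  define Q where "Q r s =
    (if r = (0::nat) then (if s = (0::nat) then (d + 1) * h else (d - 1) * h)
     else (if s = 0 then - i * (d - 1) * h else - i * (d + 1) * h))" for r s
  have less2: "r < 2 \<longleftrightarrow> r = 0 \<or> r = 1" for r :: nat by auto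
  have neg_sq: "i * u * h * (- i * w * h) = u * h * (w * h)" for u w
  proof -
    have "i * u * h * (- i * w * h) = - (i * i) * (u * h * (w * h))" by (simp only: mult_ac mult_minus_left mult_minus_right)
    then show ?thesis by (simp add: i)
  qed
  have "(c + 1) * h * ((d + 1) * h) + (c - 1) * h * ((d - 1) * h) = (2 * h) * (h * (c * d) + h)"
    "(c + 1) * h * ((d - 1) * h) + (c - 1) * h * ((d + 1) * h) = (2 * h) * (h * (c * d) - h)"
    by (simp_all add: algebra_simps)
  then have PQ: "(c + 1) * h * ((d + 1) * h) + (c - 1) * h * ((d - 1) * h) = 1"
    "(c + 1) * h * ((d - 1) * h) + (c - 1) * h * ((d + 1) * h) = 0"
    unfolding h d using h by simp_all
  have "(\<Sum>l<2. P r l * Q l s) = (if r = s then 1 else 0)" if "r < 2" "s < 2" for r s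
    using that PQ unfolding less2
    by (auto simp only: P_def Q_def numeral_2_eq_2 sum.lessThan_Suc lessThan_0 sum.empty neg_sq
        add_0_left add.commute if_True if_False refl zero_neq_one One_nat_def nat.distinct not_False_eq_True)
  moreover have "qf_val [1, -1] (\<lambda>r. \<Sum>s<2. P r s * v s) = qf_val [c, c] v" for v
  proof -
    define X where "X = (c + 1) * h * v 0 + i * (c - 1) * h * v 1"
    define Y where "Y = (c - 1) * h * v 0 + i * (c + 1) * h * v 1"
    have "X + Y = (2 * h) * (c * (v 0 + i * v 1))" "X - Y = (2 * h) * (v 0 - i * v 1)"
      by (simp_all add: X_def Y_def algebra_simps)
    then have "X\<^sup>2 - Y\<^sup>2 = c * ((v 0 + i * v 1) * (v 0 - i * v 1))"
      unfolding h by (simp add: power2_eq_square square_diff_square_factored)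
    also have "(v 0 + i * v 1) * (v 0 - i * v 1) = (v 0)\<^sup>2 - (i * i) * (v 1)\<^sup>2"
      by (simp add: algebra_simps power2_eq_square)
    finally have "X\<^sup>2 - Y\<^sup>2 = c * (v 0)\<^sup>2 + c * (v 1)\<^sup>2"
      by (simp add: i distrib_left)
    then show ?thesis
      by (simp add: qf_val_def numeral_2_eq_2 P_def X_def Y_def)
  qed
  moreover have len: "length [1, -1 :: 'a] = 2" "length [c, c] = 2" by simp_all
  ultimately show ?thesis
    unfolding isometric_def len
    by (intro conjI refl) (rule exI[of _ P], rule exI[of _ Q], blast)
qed

text \<open>Each pair of equal entries is a hyperbolic plane and vanishes in the Witt ring. The
  upper bounds thereby reduce to counting entries in multisets.\<close>

lemma witt_eq_doubles:
  fixes q r :: "'a::field list"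
  assumes two: "(2::'a) \<noteq> 0" and i: "i * i = (-1::'a)"
    and cs: "\<And>c. c \<in> set cs \<Longrightarrow> c \<noteq> 0" and eq: "mset r = mset q + (mset cs + mset cs)"
  shows "witt_eq q r"
proof -
  have "isometric (q @ hyp (length cs)) r" using cs eq
  proof (induction cs arbitrary: q)
    case Nil
    then show ?case by (simp add: hyp_def isometric_mset)
  next
    case (Cons c cs)
    have "isometric (q @ hyp (length (c # cs))) ((q @ hyp (length cs)) @ [1, -1])"
      by (rule isometric_mset) (simp add: hyp_def)
    also have "isometric \<dots> ((q @ hyp (length cs)) @ [c, c])"
      using Cons.prems by (intro isometric_append isometric_hyperbolic_plane[OF two i]) auto
    also have "isometric \<dots> ((q @ [c, c]) @ hyp (length cs))"
      by (rule isometric_mset) simp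
    also have "isometric \<dots> r"
      using Cons.prems by (intro Cons.IH) auto
    finally show ?case .
  qed
  then show ?thesis unfolding witt_eq_def by (metis append_Nil2 concat.simps(1) hyp_def replicate_0)
qed

section \<open>Lines over the field with two elements\<close>

text \<open>The subgroup grows from \<open>{0, e}\<close>: while some line \<open>a j\<close>,
  \<open>b j\<close>, \<open>a j + b j\<close> has a point in it without lying in it, one generator
  is adjoined. Each absorbed line at most doubles the order.\<close>

lemma subgroup_absorbing_lines:
  fixes a b :: "'j \<Rightarrow> 'v::ab_group_add"
  assumes char2: "\<And>v::'v. v + v = 0" and J: "finite J"
  obtains G where "finite G" "0 \<in> G" "e \<in> G" "\<And>u v. u \<in> G \<Longrightarrow> v \<in> G \<Longrightarrow> u + v \<in> G"
    "card G \<le> 2 ^ (card J + 1)"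
    "\<And>j. j \<in> J \<Longrightarrow> a j \<in> G \<and> b j \<in> G \<or> a j \<notin> G \<and> b j \<notin> G \<and> a j + b j \<notin> G"
proof -
  \<comment> \<open>\<open>T\<close> collects the lines absorbed so far; the additional 1 in the
    exponent accounts for \<open>e\<close>.\<close>
  have extend: "\<exists>G. finite G \<and> 0 \<in> G \<and> e \<in> G \<and> (\<forall>u\<in>G. \<forall>v\<in>G. u + v \<in> G) \<and> card G \<le> 2 ^ (card J + 1) \<and>
      (\<forall>j\<in>J. a j \<in> G \<and> b j \<in> G \<or> a j \<notin> G \<and> b j \<notin> G \<and> a j + b j \<notin> G)"
    if "T \<subseteq> J" "finite G" "0 \<in> G" "e \<in> G" "\<forall>u\<in>G. \<forall>v\<in>G. u + v \<in> G" "card G \<le> 2 ^ (card T + 1)"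
      "\<forall>j\<in>T. a j \<in> G \<and> b j \<in> G" for T G
    using that
  proof (induction "card (J - T)" arbitrary: T G rule: less_induct)
    case less
    show ?case
    proof (cases "\<forall>j\<in>J. a j \<in> G \<and> b j \<in> G \<or> a j \<notin> G \<and> b j \<notin> G \<and> a j + b j \<notin> G")
      case True
      have "card T \<le> card J" using less.prems(1) J by (rule card_mono[rotated])
      then have "(2::nat) ^ (card T + 1) \<le> 2 ^ (card J + 1)" by (intro power_increasing) auto
      then have "card G \<le> 2 ^ (card J + 1)" using less.prems(6) by linarith
      then show ?thesis using True less.prems by blast
    next
      case False
      then obtain j where j: "j \<in> J" "\<not> (a j \<in> G \<and> b j \<in> G)"
        "a j \<in> G \<or> b j \<in> G \<or> a j + b j \<in> G" by blast
      then have jT: "j \<notin> T" using less.prems(7) by blast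
      \<comment> \<open>A point of the line outside \<open>G\<close>. As another point lies in
        \<open>G\<close>, adjoining \<open>c\<close> brings in the whole line.\<close>
      define c where "c = (if a j \<in> G then b j else a j)"
      define G' where "G' = G \<union> (\<lambda>g. c + g) ` G"
      have G'I: "g \<in> G'" "c + g \<in> G'" if "g \<in> G" for g using that by (auto simp: G'_def)
      have cc: "c + (c + v) = v" for v using char2[of c] by (simp flip: add.assoc)
      show ?thesis
      proof (rule less.hyps)
        show "card (J - insert j T) < card (J - T)"
          using j jT J by (intro psubset_card_mono) auto
        show "insert j T \<subseteq> J" "finite G'" "0 \<in> G'" "e \<in> G'"
          using less.prems j by (auto simp: G'_def)
        show "\<forall>u\<in>G'. \<forall>v\<in>G'. u + v \<in> G'"
        proof (intro ballI)
          fix u v assume "u \<in> G'" "v \<in> G'"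
          then obtain g h where gh: "g \<in> G" "h \<in> G" "u = g \<or> u = c + g" "v = h \<or> v = c + h"
            by (auto simp: G'_def)
          then have "u + v = g + h \<or> u + v = c + (g + h)"
            using cc[of "g + h"] by (auto simp: algebra_simps)
          moreover have "g + h \<in> G'" "c + (g + h) \<in> G'"
            using G'I[of "g + h"] less.prems(5) gh(1,2) by auto
          ultimately show "u + v \<in> G'" by (elim disjE) simp_all
        qed
        have "card G' \<le> card G + card ((\<lambda>g. c + g) ` G)" unfolding G'_def by (rule card_Un_le)
        also have "\<dots> \<le> 2 * card G" using card_image_le[OF less.prems(2), of "\<lambda>g. c + g"] by simp
        also have "\<dots> \<le> 2 ^ (card (insert j T) + 1)"
          using less.prems(6) jT finite_subset[OF less.prems(1) J] by simp
        finally show "card G' \<le> 2 ^ (card (insert j T) + 1)" .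
        have "c \<in> G'" using G'I(2)[OF less.prems(3)] by simp
        \<comment> \<open>Here \<open>c\<close> is \<open>a j\<close>; either \<open>b j\<close> is
          in \<open>G\<close> already, or \<open>a j + b j\<close> is, and adding \<open>c\<close>
          to it gives \<open>b j\<close>.\<close>
        moreover have "b j \<in> G'" if "a j \<notin> G"
        proof (cases "b j \<in> G")
          case False
          then have "a j + b j \<in> G" using that j by blast
          then have "a j + (a j + b j) \<in> G'" using G'I(2) that by (simp add: c_def)
          then show ?thesis using char2[of "a j"] by (simp flip: add.assoc)
        qed (rule G'I)
        ultimately have "a j \<in> G' \<and> b j \<in> G'"
          by (cases "a j \<in> G") (auto simp: c_def G'_def)
        then show "\<forall>j\<in>insert j T. a j \<in> G' \<and> b j \<in> G'"
          using less.prems(7) by (auto simp: G'_def)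
      qed
    qed
  qed
  have "card {0, e} \<le> 2" by (simp add: card_insert_if)
  then have "\<exists>G. finite G \<and> 0 \<in> G \<and> e \<in> G \<and> (\<forall>u\<in>G. \<forall>v\<in>G. u + v \<in> G) \<and> card G \<le> 2 ^ (card J + 1) \<and>
      (\<forall>j\<in>J. a j \<in> G \<and> b j \<in> G \<or> a j \<notin> G \<and> b j \<notin> G \<and> a j + b j \<notin> G)"
    by (intro extend[of "{}" "{0, e}"]) (auto simp: char2)
  then show thesis using that by blast
qed

lemma sum_fun_apply: "(\<Sum>i\<in>A. f i) x = (\<Sum>i\<in>A. f i x)"
  by (induction A rule: infinite_finite_induct) auto

definition unit_vec :: "nat \<Rightarrow> nat \<Rightarrow> bit" where
  "unit_vec i = (\<lambda>j. of_bool (j = i))"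

lemma sum_unit_vec: "finite A \<Longrightarrow> (\<Sum>i\<in>A. unit_vec i) j = of_bool (j \<in> A)"
  by (simp add: sum_fun_apply unit_vec_def of_bool_def)

text \<open>The hypothesis \<open>eq\<close> is an equality in the group ring F_2[V] up to multiples
  of the neutral element, tested by all maps \<psi> vanishing at 0. Letting \<psi> take values in V
  allows summing the points themselves.\<close>

lemma circuit_lines_bound:
  fixes a b :: "'j \<Rightarrow> nat \<Rightarrow> bit"
  assumes n: "n \<ge> 1" and J: "finite J"
    and eq: "\<And>\<psi> :: (nat \<Rightarrow> bit) \<Rightarrow> nat \<Rightarrow> bit. \<psi> 0 = 0 \<Longrightarrow>
      \<psi> (\<Sum>i=1..n. unit_vec i) + (\<Sum>i=1..n. \<psi> (unit_vec i)) =
      (\<Sum>j\<in>J. \<psi> (a j) + \<psi> (b j) + \<psi> (a j + b j))"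
  shows "n \<le> card J + 1"
proof -
  obtain G where G: "finite G" "0 \<in> G" "unit_vec 1 \<in> G" "\<And>u v. u \<in> G \<Longrightarrow> v \<in> G \<Longrightarrow> u + v \<in> G"
    "card G \<le> 2 ^ (card J + 1)"
    "\<And>j. j \<in> J \<Longrightarrow> a j \<in> G \<and> b j \<in> G \<or> a j \<notin> G \<and> b j \<notin> G \<and> a j + b j \<notin> G"
    using subgroup_absorbing_lines[OF add_self_bit_fun J] by blast
  \<comment> \<open>This \<psi> sums the points lying in \<open>G\<close>. A line inside
    \<open>G\<close> has sum 0, and any other line has no point in \<open>G\<close>.\<close>
  define \<psi> where "\<psi> v = (if v \<in> G then v else 0)" for v :: "nat \<Rightarrow> bit"
  define s where "s = (\<Sum>i=1..n. unit_vec i)"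
  have s: "s i = of_bool (i \<in> {1..n})" for i unfolding s_def by (rule sum_unit_vec) simp
  have "\<psi> (a j) + \<psi> (b j) + \<psi> (a j + b j) = 0" if "j \<in> J" for j
    using G(6)[OF that] G(4) add_self_bit_fun[of "a j + b j"] by (auto simp: \<psi>_def)
  then have zero: "\<psi> s + (\<Sum>i=1..n. \<psi> (unit_vec i)) = 0"
    using eq[of \<psi>] unfolding s_def by (simp add: \<psi>_def)
  have coord: "(\<Sum>i=1..n. \<psi> (unit_vec i)) l = of_bool (unit_vec l \<in> G)" if "l \<in> {1..n}" for l
  proof -
    have "(\<Sum>i=1..n. \<psi> (unit_vec i)) l = (\<Sum>i=1..n. if i = l then of_bool (unit_vec l \<in> G) else 0)"
      unfolding sum_fun_apply by (intro sum.cong) (auto simp: \<psi>_def unit_vec_def)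
    then show ?thesis using that by simp
  qed
  have zero': "\<psi> s l + of_bool (unit_vec l \<in> G) = 0" if "l \<in> {1..n}" for l
    using fun_cong[OF zero, of l] coord[OF that] by simp
  \<comment> \<open>Coordinate 1 of the unit vectors in \<open>G\<close> sums to 1, which only
    \<open>s\<close> can cancel. Once \<open>s\<close> is in \<open>G\<close>, each of its other
    coordinates forces the corresponding unit vector into \<open>G\<close>.\<close>
  have "s \<in> G"
    using zero'[of 1] n G(3) by (auto simp: \<psi>_def split: if_splits)
  then have unit_G: "unit_vec l \<in> G" if "l \<in> {1..n}" for l
    using zero'[OF that] that s[of l] by (auto simp: \<psi>_def split: if_splits)
  have sum_G: "(\<Sum>i\<in>A. unit_vec i) \<in> G" if "A \<subseteq> {1..n}" for A
    using finite_subset[OF that finite_atLeastAtMost] that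
    by (induction A rule: finite_induct) (auto simp: G unit_G)
  \<comment> \<open>The sums over subsets are \<open>2 ^ n\<close> distinct elements of
    \<open>G\<close>.\<close>
  have "inj_on (\<lambda>A. \<Sum>i\<in>A. unit_vec i) (Pow {1..n})"
  proof (rule inj_onI)
    fix A B assume AB: "A \<in> Pow {1..n}" "B \<in> Pow {1..n}" "(\<Sum>i\<in>A. unit_vec i) = (\<Sum>i\<in>B. unit_vec i)"
    then have "finite A" "finite B" using finite_subset by blast+
    then have "of_bool (j \<in> A) = (of_bool (j \<in> B) :: bit)" for j
      using sum_unit_vec AB(3) by metis
    then have "j \<in> A \<longleftrightarrow> j \<in> B" for j by (simp only: of_bool_eq_iff)
    then show "A = B" by blast
  qed
  then have "card (Pow {1..n}) \<le> card G"
    using sum_G G(1) by (intro card_inj_on_le[of "\<lambda>A. \<Sum>i\<in>A. unit_vec i"]) auto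
  then have "(2::nat) ^ n \<le> 2 ^ (card J + 1)" using G(5) by (simp add: card_Pow)
  then show ?thesis by (rule power_le_imp_le_exp[rotated]) simp
qed

section \<open>Witt equivalence and Pfister sums\<close>

text \<open>The homomorphism from W(K) to F_2[V] is encoded by its pairings with arbitrary maps
  \<psi>. A hyperbolic plane contributes \<open>\<psi> 0\<close> twice, hence 0, because -1 is a
  square and has class 0.\<close>

lemma witt_eq_imp_sum_list_eq:
  fixes cls :: "'a::field \<Rightarrow> nat \<Rightarrow> bit" and \<psi> :: "(nat \<Rightarrow> bit) \<Rightarrow> nat \<Rightarrow> bit"
  assumes two: "(2::'a) \<noteq> 0" and im: "im * im = (-1::'a)"
    and mult: "\<And>a b. a \<noteq> 0 \<Longrightarrow> b \<noteq> 0 \<Longrightarrow> cls (a * b) = cls a + cls b"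
    and add: "\<And>a b. a \<noteq> 0 \<Longrightarrow> b \<noteq> 0 \<Longrightarrow> cls a \<noteq> cls b \<Longrightarrow> cls (a + b) \<in> {cls a, cls b}"
    and "nondeg q" "nondeg r" "witt_eq q r"
  shows "(\<Sum>c\<leftarrow>q. \<psi> (cls c)) = (\<Sum>c\<leftarrow>r. \<psi> (cls c))"
proof -
  obtain m m' where iso: "isometric (q @ hyp m) (r @ hyp m')"
    using assms(7) unfolding witt_eq_def by blast
  have one: "cls 1 = 0" using mult[of 1 1] add_self_bit_fun[of "cls 1"] by simp
  have "im \<noteq> 0" using im by auto
  then have minus_one: "cls (- 1) = 0"
    using mult[of im im] im add_self_bit_fun[of "cls im"] by simp
  have hyp_sum: "(\<Sum>c\<leftarrow>hyp m. \<psi> (cls c)) = 0" for m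
    by (induction m) (simp_all add: hyp_def one minus_one add_self_bit_fun flip: add.assoc)
  have nondeg_hyp: "nondeg (p @ hyp m)" if "nondeg p" for p :: "'a list" and m
    using that by (auto simp: nondeg_def hyp_def)
  have "(\<Sum>c\<leftarrow>q @ hyp m. \<psi> (cls c)) = (\<Sum>c\<leftarrow>r @ hyp m'. \<psi> (cls c))"
  proof (rule isometric_imp_sum_list_eq[OF two _ _ nondeg_hyp[OF assms(5)] nondeg_hyp[OF assms(6)] iso])
    fix a s :: 'a assume "a \<noteq> 0" "s \<noteq> 0"
    then show "\<psi> (cls (a * s\<^sup>2)) = \<psi> (cls a)"
      by (simp add: power2_eq_square mult add_self_bit_fun)
  next
    fix a b :: 'a assume ab: "a \<noteq> 0" "b \<noteq> 0" "a + b \<noteq> 0"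
    have prod: "cls (a * b * (a + b)) = cls a + cls b + cls (a + b)"
      using ab by (simp add: mult)
    \<comment> \<open>If the classes agree, each side is twice one term, hence 0. Otherwise
      \<open>a + b\<close> has one of the two classes and the product \<open>a * b * (a + b)\<close>
      has the other.\<close>
    show "\<psi> (cls a) + \<psi> (cls b) = \<psi> (cls (a + b)) + \<psi> (cls (a * b * (a + b)))"
    proof (cases "cls a = cls b")
      case True
      then show ?thesis unfolding prod by (simp add: add_self_bit_fun)
    next
      case False
      then consider "cls (a + b) = cls a" | "cls (a + b) = cls b" using add ab by blast
      then show ?thesis
      proof cases
        case 1
        then have "cls (a * b * (a + b)) = cls b"
          unfolding prod using add_self_bit_fun[of "cls a"] by (simp add: ac_simps flip: add.assoc)
        then show ?thesis using 1 by simp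
      next
        case 2
        then have "cls (a * b * (a + b)) = cls a"
          unfolding prod by (simp add: add.assoc add_self_bit_fun)
        then show ?thesis using 2 by (simp add: add.commute)
      qed
    qed
  qed
  then show ?thesis by (simp add: hyp_sum)
qed

section \<open>Sums of Pfister forms as multisets of entries\<close>

lemma pfister_1: "pfister [c] = [1, c]"
  by (simp add: tensor_def)

lemma pfister_2: "pfister [a, b] = [1, b, a, a * b]"
  by (simp add: tensor_def)

lemma pfister_nonzero: "\<forall>c\<in>set cs. c \<noteq> 0 \<Longrightarrow> 0 \<notin> set (pfister cs)"
  by (induction cs) (auto simp: tensor_def)

lemma nondeg_concat_pfister:
  assumes "\<forall>cs\<in>set L. pfister_args m cs"
  shows "nondeg (concat (map pfister L))"
  using assms pfister_nonzero unfolding nondeg_def pfister_args_def by fastforce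

lemma sum_of_pfisters_imp_in_Im:
  assumes "nondeg q" "sum_of_pfisters m N q"
  shows "in_Im m q"
proof -
  obtain L where "\<forall>cs\<in>set L. pfister_args m cs" "witt_eq q (concat (map pfister L))"
    using assms(2) unfolding sum_of_pfisters_def by blast
  \<comment> \<open>All signs are taken positive.\<close>
  then show ?thesis
    unfolding in_Im_def using assms(1)
    by (intro conjI exI[of _ "map (Pair True) L"]) (auto simp: o_def)
qed

lemma mset_replicate_even: "even n \<Longrightarrow>
    mset (replicate (n div 2) c) + mset (replicate (n div 2) c) = replicate_mset n c"
  by (rule multiset_eqI) (auto elim: evenE)

lemma mset_pfister_1_sum: "mset (concat (map pfister (map (\<lambda>c. [c]) xs))) = replicate_mset (length xs) 1 + mset xs"
  by (induction xs) (simp_all add: pfister_1 del: pfister.simps)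

text \<open>The form with index i has entries 1, \<open>x i\<close>, \<open>p (i - 1)\<close> and
  \<open>p i\<close>. Each interior partial product thus occurs in two consecutive forms,
  \<open>p 1\<close> supplies the missing \<open>x 1\<close>, and \<open>p n\<close> is left
  over.\<close>

lemma mset_pfister_2_telescope:
  assumes "n \<ge> 2" and p: "p 1 = x 1" "\<And>i. i \<ge> 1 \<Longrightarrow> p (Suc i) = p i * x (Suc i)"
  shows "mset (concat (map pfister (map (\<lambda>i. [p (i - 1), x i]) [2..<n+1]))) =
    replicate_mset (n - 1) 1 + mset (p n # map x [1..<n+1]) + (mset (map p [2..<n]) + mset (map p [2..<n]))"
  using assms(1)
proof (induction n rule: dec_induct)
  case base
  have "p 2 = x 1 * x 2" using p(2)[of 1] p(1) by (simp add: numeral_2_eq_2)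
  moreover have "[2..<2+1] = [2::nat]" "[1..<2+1] = [1, 2::nat]" "2 - 1 = (1::nat)"
    by (simp_all add: upt_rec)
  ultimately show ?case
    using p(1) by (simp add: pfister_2 del: pfister.simps)
next
  case (step n)
  have u: "[2..<Suc n + 1] = [2..<n+1] @ [Suc n]" "[1..<Suc n + 1] = [1..<n+1] @ [Suc n]"
    "[2..<Suc n] = [2..<n] @ [n]"
    using step.hyps by simp_all
  have "replicate_mset (Suc n - 1) 1 = add_mset 1 (replicate_mset (n - 1) (1::'a))"
    using step.hyps by (cases n) simp_all
  then show ?case
    unfolding u map_append concat_append mset_append step.IH
    using p(2)[of n] step.hyps by (simp add: pfister_2 del: pfister.simps upt_Suc)
qed

section \<open>Lower and upper bounds for the two Pfister numbers\<close>

theorem theorem2p2: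
  fixes k :: "'a::field set" and x :: "nat \<Rightarrow> 'a" and n :: nat
  assumes "(2::'a) \<noteq> 0"
    and "is_subfield k"
    and "\<exists>i\<in>k. i * i = -1"
    and "n \<ge> 2"
    and "alg_indep k x n"
    and "generates_field k x n"
  shows "let x0 = (\<Prod>i=1..n. x i);
             q = map x [1..<n+1];
             q0 = x0 # q;
             q' = 1 # q;
             q0' = 1 # x0 # q
         in (even n \<longrightarrow> in_Im 1 q \<and> in_Im 2 q0' \<and> Pf 1 q = n \<and> Pf 2 q0' = n - 1) \<and>
            (odd n \<longrightarrow> in_Im 1 q' \<and> in_Im 2 q0 \<and> Pf 1 q' = n \<and> Pf 2 q0 = n - 1)"
proof -
  obtain im where im: "im * im = (-1::'a)" using assms(3) by blast
  obtain cls :: "'a \<Rightarrow> nat \<Rightarrow> bit"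
    where mult: "\<And>a b. a \<noteq> 0 \<Longrightarrow> b \<noteq> 0 \<Longrightarrow> cls (a * b) = cls a + cls b"
      and add: "\<And>a b. a \<noteq> 0 \<Longrightarrow> b \<noteq> 0 \<Longrightarrow> cls a \<noteq> cls b \<Longrightarrow> cls (a + b) \<in> {cls a, cls b}"
      and cls_x: "\<And>i. i \<in> {1..n} \<Longrightarrow> cls (x i) = unit_vec i"
      and x_nz: "\<And>i. i \<in> {1..n} \<Longrightarrow> x i \<noteq> 0"
    using leading_parity_exists[OF assms(2,5,6)] unfolding unit_vec_def by blast
  note invariant = witt_eq_imp_sum_list_eq[OF assms(1) im mult add]
  have one: "cls 1 = 0" using mult[of 1 1] add_self_bit_fun[of "cls 1"] by simp
  define x0 where "x0 = (\<Prod>i=1..n. x i)"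
  define q where "q = map x [1..<n+1]"
  have x0_nz: "x0 \<noteq> 0" using x_nz by (simp add: x0_def)
  have "cls (prod x A) = (\<Sum>i\<in>A. unit_vec i) \<and> prod x A \<noteq> 0" if "A \<subseteq> {1..n}" for A
    using finite_subset[OF that finite_atLeastAtMost] that
    by (induction A rule: finite_induct) (auto simp: one mult cls_x x_nz)
  then have cls_x0: "cls x0 = (\<Sum>i=1..n. unit_vec i)" unfolding x0_def by blast
  have nd: "nondeg q" "nondeg (1 # q)" "nondeg (x0 # q)" "nondeg (1 # x0 # q)"
    using x_nz x0_nz by (auto simp: nondeg_def q_def)
  have sum_q: "(\<Sum>c\<leftarrow>q. \<psi> (cls c)) = (\<Sum>i=1..n. \<psi> (unit_vec i))" for \<psi> :: "(nat \<Rightarrow> bit) \<Rightarrow> nat \<Rightarrow> bit"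
  proof -
    have "(\<Sum>c\<leftarrow>q. \<psi> (cls c)) = (\<Sum>i\<leftarrow>[1..<n+1]. \<psi> (cls (x i)))"
      by (simp add: q_def o_def)
    also have "\<dots> = (\<Sum>i=1..n. \<psi> (cls (x i)))"
      by (simp add: interv_sum_list_conv_sum_set_nat atLeastLessThanSuc_atLeastAtMost del: upt_Suc)
    also have "\<dots> = (\<Sum>i=1..n. \<psi> (unit_vec i))"
      by (intro sum.cong) (simp_all add: cls_x)
    finally show ?thesis .
  qed
  \<comment> \<open>An extra entry 1 has class 0 and is invisible to maps with
    \<open>\<psi> 0 = 0\<close>, so both forms are treated together, whatever the parity of
    n.\<close>
  have lower1: "n \<le> N" if sp: "sum_of_pfisters 1 N r" and r: "r = q \<or> r = 1 # q" for N r
  proof -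
    obtain L where L: "length L = N" "\<forall>cs\<in>set L. pfister_args 1 cs" "witt_eq r (concat (map pfister L))"
      using sp unfolding sum_of_pfisters_def by blast
    \<comment> \<open>Every basis vector must be the class of the slot of some 1-fold form.
      Otherwise a \<psi> supported at \<open>unit_vec i\<close> alone gives
      \<open>unit_vec i\<close> for \<open>r\<close> and 0 for the Pfister sum. So the N slots carry
      at least n classes.\<close>
    have "unit_vec i \<in> (\<lambda>cs. cls (hd cs)) ` set L" if i: "i \<in> {1..n}" for i
    proof (rule ccontr)
      assume no: "\<not> ?thesis"
      define \<psi> where "\<psi> v = (if v = unit_vec i then v else 0)" for v
      have u0: "unit_vec j \<noteq> 0" for j by (auto simp: unit_vec_def fun_eq_iff)
      have unit_inj: "unit_vec j = unit_vec i \<longleftrightarrow> j = i" for j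
        by (auto simp: unit_vec_def fun_eq_iff)
      have \<psi>0: "\<psi> 0 = 0" using u0 by (auto simp: \<psi>_def)
      have "(\<Sum>c\<leftarrow>r. \<psi> (cls c)) = (\<Sum>j=1..n. \<psi> (unit_vec j))"
        using r sum_q[of \<psi>] by (auto simp: one \<psi>0)
      also have "\<dots> = unit_vec i" using i by (simp add: \<psi>_def unit_inj cong: if_cong)
      moreover have "(\<Sum>c\<leftarrow>r. \<psi> (cls c)) = (\<Sum>c\<leftarrow>concat (map pfister L). \<psi> (cls c))"
        using r nd by (intro invariant nondeg_concat_pfister[OF L(2)] L(3)) auto
      moreover have "(\<Sum>c\<leftarrow>concat (map pfister L). \<psi> (cls c)) = 0"
        using L(2) no
      proof (induction L)
        case (Cons cs L)
        then obtain c where "cs = [c]" by (auto simp: pfister_args_def length_Suc_conv)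
        then show ?case using Cons by (auto simp: pfister_1 one \<psi>0 \<psi>_def simp del: pfister.simps)
      qed simp
      ultimately show False using u0 by simp
    qed
    then have "unit_vec ` {1..n} \<subseteq> (\<lambda>cs. cls (hd cs)) ` set L" by blast
    then have "card (unit_vec ` {1..n}) \<le> card ((\<lambda>cs. cls (hd cs)) ` set L)"
      by (intro card_mono) auto
    also have "\<dots> \<le> length L"
      using card_image_le[of "set L" "\<lambda>cs. cls (hd cs)"] card_length[of L] by simp
    also have "inj_on unit_vec {1..n}" by (auto simp: inj_on_def unit_vec_def fun_eq_iff)
    then have "card (unit_vec ` {1..n}) = n" by (simp add: card_image)
    finally show ?thesis using L(1) by simp
  qed
  have lower2: "n - 1 \<le> N" if sp: "sum_of_pfisters 2 N r" and r: "r = x0 # q \<or> r = 1 # x0 # q" for N r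
  proof -
    obtain L where L: "length L = N" "\<forall>cs\<in>set L. pfister_args 2 cs" "witt_eq r (concat (map pfister L))"
      using sp unfolding sum_of_pfisters_def by blast
    have "n \<le> card {..<N} + 1"
    \<comment> \<open>The entries of \<open>pfister [a, b]\<close> are 1, b, a, \<open>a * b\<close>
      in this order, so the slot with index 1 gives the first point of the line.\<close>
    proof (rule circuit_lines_bound[where a = "\<lambda>j. cls (L ! j ! 1)" and b = "\<lambda>j. cls (L ! j ! 0)"])
      fix \<psi> :: "(nat \<Rightarrow> bit) \<Rightarrow> nat \<Rightarrow> bit" assume \<psi>0: "\<psi> 0 = 0"
      have "\<psi> (\<Sum>i=1..n. unit_vec i) + (\<Sum>i=1..n. \<psi> (unit_vec i)) = (\<Sum>c\<leftarrow>r. \<psi> (cls c))"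
        using r sum_q[of \<psi>] by (auto simp: one \<psi>0 cls_x0)
      also have "\<dots> = (\<Sum>c\<leftarrow>concat (map pfister L). \<psi> (cls c))"
        using r nd by (intro invariant nondeg_concat_pfister[OF L(2)] L(3)) auto
      also have "\<dots> = (\<Sum>cs\<leftarrow>L. \<psi> (cls (cs ! 1)) + \<psi> (cls (cs ! 0)) + \<psi> (cls (cs ! 1) + cls (cs ! 0)))"
        using L(2)
      proof (induction L)
        case (Cons cs L)
        then obtain a b where ab: "cs = [a, b]" "a \<noteq> 0" "b \<noteq> 0"
          by (auto simp: pfister_args_def length_Suc_conv numeral_2_eq_2)
        have "cls (a * b) = cls b + cls a" using mult[OF ab(2,3)] by (simp only: add.commute)
        then have "(\<Sum>c\<leftarrow>pfister cs. \<psi> (cls c)) =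
            \<psi> (cls (cs ! 1)) + \<psi> (cls (cs ! 0)) + \<psi> (cls (cs ! 1) + cls (cs ! 0))"
          unfolding ab(1) pfister_2 by (simp only: list.map sum_list.Cons sum_list.Nil one \<psi>0
              add_0_left add_0_right add.assoc nth_Cons_0 nth_Cons_Suc One_nat_def)
        moreover have "\<forall>cs\<in>set L. pfister_args 2 cs" using Cons.prems by simp
        ultimately show ?case
          using Cons.IH by (simp only: list.map concat.simps map_append sum_list.append sum_list.Cons)
      qed simp
      also have "\<dots> = (\<Sum>j<N. \<psi> (cls (L ! j ! 1)) + \<psi> (cls (L ! j ! 0)) + \<psi> (cls (L ! j ! 1) + cls (L ! j ! 0)))"
        unfolding L(1)[symmetric] by (rule sum_lessThan_length_nth[symmetric])
      finally show "\<psi> (\<Sum>i=1..n. unit_vec i) + (\<Sum>i=1..n. \<psi> (unit_vec i)) = \<dots>" .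
    qed (use assms(4) in auto)
    then show ?thesis by simp
  qed
  have upper1: "sum_of_pfisters 1 n r" if r: "even n \<and> r = q \<or> odd n \<and> r = 1 # q" for r
  proof -
    let ?L = "map (\<lambda>c. [c]) q"
    \<comment> \<open>The number of surplus entries 1: all n of them, or \<open>n - 1\<close> when
      one belongs to \<open>r\<close>. It is even, so they cancel in pairs.\<close>
    define m where "m = (if even n then n else n - 1)"
    have "even m" using assms(4) by (auto simp: m_def)
    have "length q = n" by (simp add: q_def)
    have "mset (concat (map pfister ?L)) = mset r + replicate_mset m 1"
      unfolding mset_pfister_1_sum \<open>length q = n\<close> using r assms(4)
      by (cases n) (auto simp: m_def)
    note this[folded mset_replicate_even[OF \<open>even m\<close>]]
    then have "witt_eq r (concat (map pfister ?L))"
      by (rule witt_eq_doubles[OF assms(1) im, rotated]) simp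
    then show ?thesis
      using nd(1) unfolding sum_of_pfisters_def
      by (intro exI[of _ ?L]) (auto simp: q_def pfister_args_def nondeg_def)
  qed
  have upper2: "sum_of_pfisters 2 (n - 1) r" if r: "odd n \<and> r = x0 # q \<or> even n \<and> r = 1 # x0 # q" for r
  proof -
    define p where "p i = prod x {1..i}" for i
    let ?L = "map (\<lambda>i. [p (i - 1), x i]) [2..<n+1]"
    \<comment> \<open>The \<open>n - 1\<close> forms contribute \<open>n - 1\<close> entries 1; for
      even n one of them belongs to \<open>r\<close>, which again leaves an even number to
      cancel.\<close>
    define m where "m = (if odd n then n - 1 else n - 2)"
    have "even m" using assms(4) by (auto simp: m_def)
    have p_nz: "p i \<noteq> 0" if "i \<le> n" for i
      using x_nz that by (auto simp: p_def)
    have "mset (concat (map pfister ?L)) =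
        replicate_mset (n - 1) 1 + mset (p n # q) + (mset (map p [2..<n]) + mset (map p [2..<n]))"
      unfolding q_def using assms(4) by (intro mset_pfister_2_telescope) (auto simp: p_def mult.commute)
    also have "replicate_mset (n - 1) 1 + mset (p n # q) = mset r + replicate_mset m 1"
    proof -
      have "odd n \<or> n - 1 = Suc (n - 2)" using assms(4) by auto
      then show ?thesis using r by (auto simp: m_def p_def x0_def)
    qed
    also have "replicate_mset m 1 = mset (replicate (m div 2) 1) + mset (replicate (m div 2) (1::'a))"
      by (rule mset_replicate_even[OF \<open>even m\<close>, symmetric])
    finally have "mset (concat (map pfister ?L)) = mset r +
        (mset (replicate (m div 2) 1 @ map p [2..<n]) + mset (replicate (m div 2) 1 @ map p [2..<n]))"
      by (simp add: ac_simps del: mset_replicate)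
    then have "witt_eq r (concat (map pfister ?L))"
      by (rule witt_eq_doubles[OF assms(1) im, rotated]) (use p_nz in auto)
    then show ?thesis
      using x_nz p_nz unfolding sum_of_pfisters_def
      by (intro exI[of _ ?L]) (auto simp: pfister_args_def)
  qed
  have Pf1: "Pf 1 r = n" if "even n \<and> r = q \<or> odd n \<and> r = 1 # q" for r
    unfolding Pf_def using upper1[OF that] lower1 that by (intro Least_equality) auto
  have Pf2: "Pf 2 r = n - 1" if "odd n \<and> r = x0 # q \<or> even n \<and> r = 1 # x0 # q" for r
    unfolding Pf_def using upper2[OF that] lower2 that by (intro Least_equality) auto
  show ?thesis
    unfolding Let_def x0_def[symmetric] q_def[symmetric]
    using sum_of_pfisters_imp_in_Im[OF _ upper1] sum_of_pfisters_imp_in_Im[OF _ upper2] Pf1 Pf2 nd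
    by simp
qed

end
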